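(* Let $\mathbf M$ be a balanced residuated partially ordered semigroup, let $\Omega$ be a $\tau$-residuation-coherent skeleton partition of $\operatorname{Sk}(\mathbf M)$, and let $A\in\Omega$. Then the component algebra $\mathbf L_A$, whose carrier is $L_A=\{x\in M:\tau(x)\in A\}$ and whose order, multiplication and residuals are the restrictions of those of $\mathbf M$, is a balanced residuated partially ordered semigroup (in particular $L_A$ is closed under the three operations). Moreover $$\operatorname{Sk}(\mathbf L_A)=A=\operatorname{Sk}(\mathbf M)\cap L_A,\qquad A=\{\tau(x):x\in L_A\},$$ and the intrinsic local-unit map $x\mapsto x\backslash_A x=x/_Ax$ of $\mathbf L_A$ is the restriction of the ambient map $\tau$.
   Context: A residuated partially ordered semigroup is a structure $\mathbf M=\langle M,\le,\cdot,\backslash,/\rangle$ with $\langle M,\le\rangle$ a poset, $\langle M,\cdot\rangle$ a semigroup, and $xy\le z\iff x\le z/y\iff y\le x\backslash z$. An element $p\in M$ is positive if $z\le zp$ and $z\le pz$ for all $z\in M$. $\mathbf M$ is balanced if for every $x\in M$ one has $x\backslash x=x/x$ and this common value is positive; it is then automatically idempotent. Put $\tau(x):=x\backslash x=x/x$ (the local unit of $x$). The positive-idempotent skeleton $\operatorname{Sk}(\mathbf M)$ is the set of positive idempotents of $\mathbf M$ with the inherited order; $\operatorname{Sk}(\mathbf L_A)$ is defined in the same way, with positivity tested only against elements of $L_A$. For $A\subseteq S=\operatorname{Sk}(\mathbf M)$ put $L_A:=\{x\in M:\tau(x)\in A\}$. A skeleton partition is a partition of $S$. For $A,B\subseteq S$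 put $A\star_\tau B:=\{\tau(xy),\tau(x\backslash y),\tau(x/y): x\in L_A,\ y\in L_B\}$. A skeleton partition $\Omega$ is $\tau$-residuation-coherent if for all $A,B\in\Omega$ exactly one block of $\Omega$ meets $A\star_\tau B$. *)

theory Defs
  imports "HOL-Algebra.Congruence" "HOL-Library.Disjoint_Sets"
begin

text \<open>Structures are carrier-based: the order and the operations are total HOL functions that are
  only constrained, and only inspected, on the carrier.\<close>

record 'a res_algebra = "'a partial_object" +
  leq :: "'a \<Rightarrow> 'a \<Rightarrow> bool" (infix "\<sqsubseteq>\<index>" 50)
  mul :: "'a \<Rightarrow> 'a \<Rightarrow> 'a" (infixl "\<odot>\<index>" 70)
  under :: "'a \<Rightarrow> 'a \<Rightarrow> 'a" (infix "\<setminus>\<index>" 70) \<comment> \<open>left residual: \<open>x \<setminus> y\<close> has the denominator on the left\<close>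
  over :: "'a \<Rightarrow> 'a \<Rightarrow> 'a" (infix "\<oslash>\<index>" 70) \<comment> \<open>right residual: \<open>x \<oslash> y\<close> has the denominator on the right\<close>

locale residuated_posemigroup =
  fixes M :: "'a res_algebra" (structure)
  assumes mul_closed: "\<And>x y. x \<in> carrier M \<Longrightarrow> y \<in> carrier M \<Longrightarrow> x \<odot> y \<in> carrier M"
    and under_closed: "\<And>x y. x \<in> carrier M \<Longrightarrow> y \<in> carrier M \<Longrightarrow> x \<setminus> y \<in> carrier M"
    and over_closed: "\<And>x y. x \<in> carrier M \<Longrightarrow> y \<in> carrier M \<Longrightarrow> x \<oslash> y \<in> carrier M"
    and leq_refl: "reflp_on (carrier M) (\<sqsubseteq>)"
    and leq_antisym: "antisymp_on (carrier M) (\<sqsubseteq>)"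
    and leq_trans: "transp_on (carrier M) (\<sqsubseteq>)"
    and mul_assoc: "\<And>x y z. x \<in> carrier M \<Longrightarrow> y \<in> carrier M \<Longrightarrow> z \<in> carrier M
      \<Longrightarrow> (x \<odot> y) \<odot> z = x \<odot> (y \<odot> z)"
    and over_residual: "\<And>x y z. x \<in> carrier M \<Longrightarrow> y \<in> carrier M \<Longrightarrow> z \<in> carrier M
      \<Longrightarrow> x \<odot> y \<sqsubseteq> z \<longleftrightarrow> x \<sqsubseteq> z \<oslash> y"
    and under_residual: "\<And>x y z. x \<in> carrier M \<Longrightarrow> y \<in> carrier M \<Longrightarrow> z \<in> carrier M
      \<Longrightarrow> x \<odot> y \<sqsubseteq> z \<longleftrightarrow> y \<sqsubseteq> x \<setminus> z"

definition positive :: "'a res_algebra \<Rightarrow> 'a \<Rightarrow> bool" where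
  "positive M p \<longleftrightarrow> p \<in> carrier M \<and>
     (\<forall>z\<in>carrier M. z \<sqsubseteq>\<^bsub>M\<^esub> z \<odot>\<^bsub>M\<^esub> p \<and> z \<sqsubseteq>\<^bsub>M\<^esub> p \<odot>\<^bsub>M\<^esub> z)"

locale balanced_residuated_posemigroup = residuated_posemigroup +
  assumes under_self_eq_over_self: "\<And>x. x \<in> carrier M \<Longrightarrow> x \<setminus> x = x \<oslash> x"
    and under_self_positive: "\<And>x. x \<in> carrier M \<Longrightarrow> positive M (x \<setminus> x)"

text \<open>In a balanced structure the local unit is equally \<open>x \<oslash> x\<close>.\<close>

definition local_unit :: "'a res_algebra \<Rightarrow> 'a \<Rightarrow> 'a" where
  "local_unit M x = x \<setminus>\<^bsub>M\<^esub> x"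

definition skeleton :: "'a res_algebra \<Rightarrow> 'a set" where
  "skeleton M = {p. positive M p \<and> p \<odot>\<^bsub>M\<^esub> p = p}"

definition component_carrier :: "'a res_algebra \<Rightarrow> 'a set \<Rightarrow> 'a set" where
  "component_carrier M A = {x \<in> carrier M. local_unit M x \<in> A}"

text \<open>Shrinking the carrier restricts the order and the operations. That the operations stay inside
  the smaller carrier is not built in; it is part of \<^const>\<open>residuated_posemigroup\<close>.\<close>

definition component_algebra :: "'a res_algebra \<Rightarrow> 'a set \<Rightarrow> 'a res_algebra" where
  "component_algebra M A = M\<lparr>carrier := component_carrier M A\<rparr>"

definition skeleton_partition :: "'a res_algebra \<Rightarrow> 'a set set \<Rightarrow> bool" where
  "skeleton_partition M \<Omega> \<longleftrightarrow> partition_on (skeleton M) \<Omega>"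

definition tau_star :: "'a res_algebra \<Rightarrow> 'a set \<Rightarrow> 'a set \<Rightarrow> 'a set" where
  "tau_star M A B =
     (\<Union>x\<in>component_carrier M A. \<Union>y\<in>component_carrier M B.
        {local_unit M (x \<odot>\<^bsub>M\<^esub> y), local_unit M (x \<setminus>\<^bsub>M\<^esub> y), local_unit M (x \<oslash>\<^bsub>M\<^esub> y)})"

definition tau_residuation_coherent :: "'a res_algebra \<Rightarrow> 'a set set \<Rightarrow> bool" where
  "tau_residuation_coherent M \<Omega> \<longleftrightarrow>
     (\<forall>A\<in>\<Omega>. \<forall>B\<in>\<Omega>. \<exists>!C. C \<in> \<Omega> \<and> C \<inter> tau_star M A B \<noteq> {})"

end

theory Submission
  imports Defs
begin

text \<open>The local unit is a retraction of the carrier onto the skeleton. Hence a block \<open>A\<close> meets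
  \<open>A \<star> A\<close>, because \<open>p = \<tau>(p \<cdot> p)\<close> for every \<open>p \<in> A\<close>; by coherence no other block does,
  and so the component of \<open>A\<close> is closed under the operations. It is then itself balanced with the
  restricted \<open>\<tau>\<close>, and applying the retraction property inside the component identifies its
  intrinsic skeleton with \<open>\<tau>(L\<^sub>A) = A\<close>.\<close>

context residuated_posemigroup
begin

lemma le_antisym:
  assumes "x \<in> carrier M" "y \<in> carrier M" "x \<sqsubseteq> y" "y \<sqsubseteq> x"
  shows "x = y"
  using assms leq_antisym by (blast dest: antisymp_onD)

lemma le_trans:
  assumes "x \<in> carrier M" "y \<in> carrier M" "z \<in> carrier M" "x \<sqsubseteq> y" "y \<sqsubseteq> z"
  shows "x \<sqsubseteq> z"
  using assms leq_trans by (blast dest: transp_onD)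

lemma le_refl: "x \<in> carrier M \<Longrightarrow> x \<sqsubseteq> x"
  using leq_refl by (blast dest: reflp_onD)

lemma local_unit_closed: "x \<in> carrier M \<Longrightarrow> local_unit M x \<in> carrier M"
  by (simp add: local_unit_def under_closed)

lemma mul_local_unit_le: "x \<in> carrier M \<Longrightarrow> x \<odot> local_unit M x \<sqsubseteq> x"
  by (simp add: local_unit_def under_residual under_closed le_refl)

text \<open>Positivity of \<open>p\<close>, tested at \<open>local_unit M p\<close>, gives \<tau>(p)
  \<le> p \<cdot> \<tau>(p) \<le> p; conversely p \<cdot> p \<le> p residuates to p \<le>
  \<tau>(p).\<close>

lemma local_unit_skeleton:
  assumes "p \<in> skeleton M"
  shows "local_unit M p = p"
proof (rule le_antisym)
  have p: "p \<in> carrier M" "p \<odot> p = p" and pos: "positive M p"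
    using assms by (auto simp: skeleton_def positive_def)
  show "p \<in> carrier M" "local_unit M p \<in> carrier M"
    using p local_unit_closed by auto
  have "local_unit M p \<sqsubseteq> p \<odot> local_unit M p"
    using p pos local_unit_closed by (auto simp: positive_def)
  then show "local_unit M p \<sqsubseteq> p"
    using le_trans[OF _ _ _ _ mul_local_unit_le] p local_unit_closed mul_closed by blast
  show "p \<sqsubseteq> local_unit M p"
    using p under_residual[of p p p] le_refl[of p] by (simp add: local_unit_def)
qed

end

context balanced_residuated_posemigroup
begin

text \<open>Balance supplies positivity, which also yields t \<le> t \<cdot> t for t = \<tau>(x).
  For the converse, x absorbs t twice: x \<cdot> (t \<cdot> t) \<le> x residuates to t \<cdot> t
  \<le> t.\<close>

lemma local_unit_in_skeleton:
  assumes x: "x \<in> carrier M"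
  shows "local_unit M x \<in> skeleton M"
proof -
  define t where "t = local_unit M x"
  have t: "t \<in> carrier M" and pos: "positive M t"
    using x under_self_positive by (auto simp: t_def local_unit_closed, simp add: local_unit_def)
  have xt: "x \<odot> t \<sqsubseteq> x"
    using x by (simp add: t_def mul_local_unit_le)
  \<comment> \<open>Monotonicity of multiplication by \<open>t\<close> is obtained through its right
    adjoint: x \<cdot> t \<le> x \<le> \<open>x \<oslash> t\<close> gives (x \<cdot> t) \<cdot> t
    \<le> x.\<close>
  moreover have "x \<sqsubseteq> x \<oslash> t"
    using xt x t over_residual by blast
  ultimately have "x \<odot> t \<sqsubseteq> x \<oslash> t"
    using x t le_trans mul_closed over_closed by metis
  then have "(x \<odot> t) \<odot> t \<sqsubseteq> x"
    using x t over_residual mul_closed by blast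
  then have "t \<odot> t \<sqsubseteq> t"
    using x t under_residual[of x "t \<odot> t" x]
    by (simp add: mul_assoc mul_closed) (simp add: t_def local_unit_def)
  moreover have "t \<sqsubseteq> t \<odot> t"
    using pos t by (auto simp: positive_def)
  ultimately have "t \<odot> t = t"
    using le_antisym t mul_closed by blast
  then show ?thesis
    using pos by (simp add: skeleton_def t_def)
qed

lemma component_closed:
  assumes part: "skeleton_partition M \<Omega>" and coh: "tau_residuation_coherent M \<Omega>"
    and A: "A \<in> \<Omega>"
    and x: "x \<in> component_carrier M A" and y: "y \<in> component_carrier M A"
  shows "x \<odot> y \<in> component_carrier M A"
    and "x \<setminus> y \<in> component_carrier M A"
    and "x \<oslash> y \<in> component_carrier M A"
proof -
  have partition: "partition_on (skeleton M) \<Omega>"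
    using part by (simp add: skeleton_partition_def)
  obtain p where p: "p \<in> A"
    using partition_onD3[OF partition] A by (metis ex_in_conv)
  then have sk: "p \<in> skeleton M"
    using partition_onD1[OF partition] A by blast
  then have "p \<in> component_carrier M A" and "local_unit M (p \<odot> p) = p"
    using p local_unit_skeleton
    by (auto simp: component_carrier_def skeleton_def positive_def)
  then have "A \<inter> tau_star M A A \<noteq> {}"
    using p unfolding tau_star_def by force
  then have only: "C = A" if "C \<in> \<Omega>" "C \<inter> tau_star M A A \<noteq> {}" for C
    using that coh A unfolding tau_residuation_coherent_def by blast
  \<comment> \<open>The blocks cover the skeleton, so \<tau>(z) lies in some block; that block meets
    \<open>tau_star M A A\<close> at \<tau>(z) and is therefore \<open>A\<close>.\<close>
  have *: "z \<in> component_carrier M A"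
    if z: "z \<in> carrier M" "local_unit M z \<in> tau_star M A A" for z
  proof -
    obtain C where "C \<in> \<Omega>" "local_unit M z \<in> C"
      using local_unit_in_skeleton[OF z(1)] partition_onD1[OF partition] by blast
    with only z show ?thesis
      by (auto simp: component_carrier_def)
  qed
  have "x \<in> carrier M" "y \<in> carrier M"
    using x y by (auto simp: component_carrier_def)
  moreover have "local_unit M (x \<odot> y) \<in> tau_star M A A"
    "local_unit M (x \<setminus> y) \<in> tau_star M A A" "local_unit M (x \<oslash> y) \<in> tau_star M A A"
    using x y unfolding tau_star_def by blast+
  ultimately show "x \<odot> y \<in> component_carrier M A" "x \<setminus> y \<in> component_carrier M A"
    "x \<oslash> y \<in> component_carrier M A"
    using * mul_closed under_closed over_closed by auto
qed

text \<open>Once closure is known, the remaining axioms are universal and pass to the smaller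
  carrier. Positivity also passes down, being tested against fewer elements.\<close>

lemma component_algebra_balanced:
  assumes "skeleton_partition M \<Omega>" "tau_residuation_coherent M \<Omega>" "A \<in> \<Omega>"
  shows "balanced_residuated_posemigroup (component_algebra M A)"
proof -
  note closed = component_closed[OF assms]
  have sub: "component_carrier M A \<subseteq> carrier M"
    by (auto simp: component_carrier_def)
  note mem = subsetD[OF sub]
  show ?thesis
  proof unfold_locales
    show "reflp_on (carrier (component_algebra M A)) (\<sqsubseteq>\<^bsub>component_algebra M A\<^esub>)"
      using reflp_on_subset[OF leq_refl sub] by (simp add: component_algebra_def)
    show "antisymp_on (carrier (component_algebra M A)) (\<sqsubseteq>\<^bsub>component_algebra M A\<^esub>)"
      using antisymp_on_subset[OF leq_antisym sub] by (simp add: component_algebra_def)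
    show "transp_on (carrier (component_algebra M A)) (\<sqsubseteq>\<^bsub>component_algebra M A\<^esub>)"
      using transp_on_subset[OF leq_trans sub] by (simp add: component_algebra_def)
    show "positive (component_algebra M A)
        (x \<setminus>\<^bsub>component_algebra M A\<^esub> x)" if "x \<in> carrier (component_algebra M A)" for x
      using that closed(2)[of x x] under_self_positive[of x] mem
      by (auto simp: component_algebra_def positive_def)
  \<comment> \<open>The residuation laws are reversed so that both rewrite towards products;
    forwards, they would compete for the same inequality.\<close>
  qed (auto simp: component_algebra_def closed mem mul_assoc under_self_eq_over_self
      over_residual[symmetric] under_residual[symmetric])
qed

end

theorem proposition5p2:
  fixes M :: "'a res_algebra" and \<Omega> :: "'a set set" and A :: "'a set"
  assumes "balanced_residuated_posemigroup M"
    and "skeleton_partition M \<Omega>"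
    and "tau_residuation_coherent M \<Omega>"
    and "A \<in> \<Omega>"
  defines "L \<equiv> component_algebra M A"
  shows "balanced_residuated_posemigroup L
    \<and> skeleton L = A
    \<and> A = skeleton M \<inter> carrier L
    \<and> A = local_unit M ` carrier L
    \<and> (\<forall>x\<in>carrier L. x \<setminus>\<^bsub>L\<^esub> x = local_unit M x \<and> x \<oslash>\<^bsub>L\<^esub> x = local_unit M x)"
proof -
  interpret balanced_residuated_posemigroup M by fact
  have L: "balanced_residuated_posemigroup L"
    unfolding L_def using assms(2-4) by (rule component_algebra_balanced)
  then interpret L: balanced_residuated_posemigroup L .
  \<comment> \<open>Only the carrier field changes, so the two local-unit maps agree as total
    functions.\<close>
  have carrier_L: "carrier L = component_carrier M A"
    and tau: "local_unit L = local_unit M"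
    by (auto simp: L_def component_algebra_def local_unit_def)
  have A_sk: "A \<subseteq> skeleton M"
    using assms(2,4) partition_onD1 unfolding skeleton_partition_def by blast
  have A_fix: "local_unit M p = p" if "p \<in> A" for p
    using that A_sk local_unit_skeleton by blast
  have A_L: "A \<subseteq> carrier L"
    using A_sk A_fix by (auto simp: carrier_L component_carrier_def skeleton_def positive_def)
  have tau_A: "local_unit M x \<in> A" if "x \<in> carrier L" for x
    using that by (simp add: carrier_L component_carrier_def)
  have "A = skeleton M \<inter> carrier L"
    using A_sk A_L tau_A local_unit_skeleton by force
  moreover have "A = local_unit M ` carrier L"
    using A_L A_fix tau_A by force
  moreover have "skeleton L = A"
  proof
    \<comment> \<open>Positivity in \<open>L\<close> is weaker than in \<open>M\<close>, so the
      fixed-point lemma is applied inside \<open>L\<close>: p = \<tau>(p), and \<tau> maps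
      \<open>carrier L\<close> into \<open>A\<close>.\<close>
    show "skeleton L \<subseteq> A"
    proof
      fix p assume p: "p \<in> skeleton L"
      then have "p \<in> carrier L"
        by (simp add: skeleton_def positive_def)
      with tau_A L.local_unit_skeleton[OF p] show "p \<in> A"
        by (metis tau)
    qed
    \<comment> \<open>Each \<open>p\<close> in \<open>A\<close> is its own local unit, and local
      units of \<open>L\<close> are positive idempotents of \<open>L\<close>.\<close>
    show "A \<subseteq> skeleton L"
    proof
      fix p assume "p \<in> A"
      with A_L have "local_unit L p \<in> skeleton L"
        by (blast intro: L.local_unit_in_skeleton)
      with A_fix[OF \<open>p \<in> A\<close>] show "p \<in> skeleton L"
        by (simp add: tau)
    qed
  qed
  moreover have "x \<setminus>\<^bsub>L\<^esub> x = local_unit M x \<and> x \<oslash>\<^bsub>L\<^esub> x = local_unit M x"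
    if "x \<in> carrier L" for x
    using L.under_self_eq_over_self[OF that] tau by (metis local_unit_def)
  ultimately show ?thesis
    using L by blast
qed

end
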